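(* Let $d\ge1$ and $t\ge1$ be integers and let $Z\subset\mathfrak{S}_d$ be a subgroup that is $(t-1)$-transitive and $t$-homogeneous. Then for every $x\in\mathbb{R}^d$ and every $f\in\mathbb{R}_t[y_1,\ldots,y_d]$, \[ \frac{1}{|\mathfrak{S}_d\cdot x|}\sum_{y\in\mathfrak{S}_d\cdot x}f(y)=\frac{1}{|Z\cdot x|}\sum_{y\in Z\cdot x}f(y). \]
   Context: $\mathfrak{S}_d$ is the symmetric group on $[d]=\{1,\ldots,d\}$. For $x=(x_1,\ldots,x_d)\in\mathbb{R}^d$ and a subgroup $Z\le\mathfrak{S}_d$, $Z\cdot x=\{(x_{\sigma(1)},\ldots,x_{\sigma(d)})\mid\sigma\in Z\}$ (a set). A subgroup $H\le\mathfrak{S}_d$ is $k$-homogeneous if it acts transitively on the set of $k$-element subsets of $[d]$, and $k$-transitive if it acts transitively on the set of ordered $k$-tuples of distinct elements of $[d]$ (every subgroup is $0$-transitive). $\mathbb{R}_t[y_1,\ldots,y_d]$ is the space of real polynomials of total degree at most $t$. *)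

theory Defs
  imports
    Complex_Main
    "HOL-Library.FuncSet"
    "HOL-Library.Poly_Mapping"
    "HOL-Algebra.Sym_Groups"
    "HOL-Algebra.Group_Action"
begin

text \<open>
  The space of real vectors of length \<open>d\<close> is \<open>{1..d} \<rightarrow>\<^sub>E UNIV\<close>: outside \<open>{1..d}\<close> a vector takes the
  fixed value \<open>undefined\<close>, so that equality of functions is equality of vectors.  This set is closed
  under composition with elements of \<open>sym_group d\<close>.
\<close>

definition perm_orbit :: "(nat \<Rightarrow> nat) set \<Rightarrow> (nat \<Rightarrow> real) \<Rightarrow> (nat \<Rightarrow> real) set" where
  "perm_orbit Z x = {(\<lambda>i. x (\<sigma> i)) | \<sigma>. \<sigma> \<in> Z}"

text \<open>
  An action is transitive if it has exactly one orbit; in particular the set acted on is nonempty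
  (this differs from the locale \<open>transitive_action\<close>, which admits the empty set).  Hence
  \<open>k\<close>-transitivity and \<open>k\<close>-homogeneity include \<open>k \<le> d\<close>.
\<close>

definition acts_transitively_on :: "nat \<Rightarrow> (nat \<Rightarrow> nat) set \<Rightarrow> ((nat \<Rightarrow> nat) \<Rightarrow> 'b \<Rightarrow> 'b) \<Rightarrow> 'b set \<Rightarrow> bool" where
  "acts_transitively_on d H \<phi> E \<longleftrightarrow> orbits ((sym_group d)\<lparr>carrier := H\<rparr>) E \<phi> = {E}"

definition homogeneous :: "nat \<Rightarrow> nat \<Rightarrow> (nat \<Rightarrow> nat) set \<Rightarrow> bool" where
  "homogeneous d k H \<longleftrightarrow>
     acts_transitively_on d H (\<lambda>\<sigma> A. \<sigma> ` A) {A. A \<subseteq> {1..d} \<and> card A = k}"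

definition multiply_transitive :: "nat \<Rightarrow> nat \<Rightarrow> (nat \<Rightarrow> nat) set \<Rightarrow> bool" where
  "multiply_transitive d k H \<longleftrightarrow>
     acts_transitively_on d H map {xs. length xs = k \<and> distinct xs \<and> set xs \<subseteq> {1..d}}"

text \<open>
  A polynomial maps each monomial to its coefficient, and a monomial maps each variable index to
  its exponent.
\<close>

type_synonym real_mpoly = "(nat \<Rightarrow>\<^sub>0 nat) \<Rightarrow>\<^sub>0 real"

definition monomial_degree :: "(nat \<Rightarrow>\<^sub>0 nat) \<Rightarrow> nat" where
  "monomial_degree m = (\<Sum>i\<in>Poly_Mapping.keys m. Poly_Mapping.lookup m i)"

definition mpolys_le :: "nat \<Rightarrow> nat \<Rightarrow> real_mpoly set" where
  "mpolys_le d t =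
     {f. \<forall>m\<in>Poly_Mapping.keys f. Poly_Mapping.keys m \<subseteq> {1..d} \<and> monomial_degree m \<le> t}"

definition mpoly_eval :: "real_mpoly \<Rightarrow> (nat \<Rightarrow> real) \<Rightarrow> real" where
  "mpoly_eval f y =
     (\<Sum>m\<in>Poly_Mapping.keys f. Poly_Mapping.lookup f m *
        (\<Prod>i\<in>Poly_Mapping.keys m. y i ^ Poly_Mapping.lookup m i))"

end

theory Submission
  imports Defs
begin

text \<open>
  Averages over an orbit are averages over the group, since all fibres of \<open>\<sigma> \<mapsto> x \<circ> \<sigma>\<close> have the same
  size. By linearity it suffices to treat a monomial \<open>M\<close> of degree at most \<open>t\<close>. For every permutation
  \<open>\<tau>\<close> there is \<open>\<rho> \<in> Z\<close> with \<open>M (y \<circ> \<tau>) = M (y \<circ> \<rho>)\<close> for all \<open>y\<close>: if \<open>M\<close> involves fewer than \<open>t\<close>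
  variables, \<open>\<rho>\<close> can be chosen to agree with \<open>\<tau>\<close> on them; otherwise \<open>M\<close> is a product of \<open>t\<close> distinct
  variables and \<open>\<rho>\<close> need only have the same image on this set of variables. Hence
  \<open>\<Sum>\<sigma>\<in>Z. M (x \<circ> \<sigma> \<circ> \<tau>)\<close> does not depend on \<open>\<tau>\<close>, and summing over \<open>\<tau>\<close> gives the claim.
\<close>

lemma perm_orbit_eq_image: "perm_orbit Z x = (\<lambda>\<sigma>. x \<circ> \<sigma>) ` Z"
  by (auto simp: perm_orbit_def comp_def)

lemma subgroup_sym_groupD:
  assumes "subgroup Z (sym_group d)"
  shows "finite Z" "id \<in> Z"
    and "\<And>\<sigma>. \<sigma> \<in> Z \<Longrightarrow> \<sigma> permutes {1..d}"
    and "\<And>\<sigma> \<tau>. \<sigma> \<in> Z \<Longrightarrow> \<tau> \<in> Z \<Longrightarrow> \<sigma> \<circ> \<tau> \<in> Z"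
    and "\<And>\<sigma>. \<sigma> \<in> Z \<Longrightarrow> inv_into UNIV \<sigma> \<in> Z"
proof -
  interpret subgroup Z "sym_group d" by (rule assms)
  have sub: "Z \<subseteq> {p. p permutes {1..d}}"
    using subset by (auto simp: sym_group_def)
  then show "finite Z"
    by (rule finite_subset) (simp add: finite_permutations)
  show "id \<in> Z"
    using one_closed by (simp add: sym_group_def)
  show "\<sigma> permutes {1..d}" if "\<sigma> \<in> Z" for \<sigma>
    using sub that by auto
  show "\<sigma> \<circ> \<tau> \<in> Z" if "\<sigma> \<in> Z" "\<tau> \<in> Z" for \<sigma> \<tau>
    using m_closed[OF that] by (simp add: sym_group_def)
  show "inv_into UNIV \<sigma> \<in> Z" if "\<sigma> \<in> Z" for \<sigma>
    using m_inv_closed[OF that] sym_group_inv_equality[of \<sigma> d] subset that by auto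
qed

lemma bij_betw_comp_right_subgroup:
  assumes "subgroup Z (sym_group d)" and "\<tau> \<in> Z"
  shows "bij_betw (\<lambda>\<sigma>. \<sigma> \<circ> \<tau>) Z Z"
proof (rule bij_betwI[where g = "\<lambda>\<sigma>. \<sigma> \<circ> inv_into UNIV \<tau>"])
  note Z = subgroup_sym_groupD[OF assms(1)]
  have \<tau>: "\<tau> permutes {1..d}" by (rule Z(3)[OF assms(2)])
  show "(\<lambda>\<sigma>. \<sigma> \<circ> \<tau>) \<in> Z \<rightarrow> Z" "(\<lambda>\<sigma>. \<sigma> \<circ> inv_into UNIV \<tau>) \<in> Z \<rightarrow> Z"
    using Z(4,5) assms(2) by auto
  show "\<sigma> \<circ> \<tau> \<circ> inv_into UNIV \<tau> = \<sigma>" "\<sigma> \<circ> inv_into UNIV \<tau> \<circ> \<tau> = \<sigma>" for \<sigma> :: "nat \<Rightarrow> nat"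
    using permutes_inv_o[OF \<tau>] by (simp_all add: comp_assoc)
qed

lemma orbit_average_eq_group_average:
  fixes F :: "(nat \<Rightarrow> real) \<Rightarrow> real"
  assumes "subgroup Z (sym_group d)"
  shows "1 / real (card (perm_orbit Z x)) * (\<Sum>y\<in>perm_orbit Z x. F y)
       = 1 / real (card Z) * (\<Sum>\<sigma>\<in>Z. F (x \<circ> \<sigma>))"
proof -
  note Z = subgroup_sym_groupD[OF assms]
  define c where "c = card {\<sigma>\<in>Z. x \<circ> \<sigma> = x}"
  have fibre: "card {\<sigma>\<in>Z. x \<circ> \<sigma> = y} = c" if y: "y \<in> perm_orbit Z x" for y
  proof -
    obtain \<tau> where \<tau>: "\<tau> \<in> Z" "y = x \<circ> \<tau>"
      using y by (auto simp: perm_orbit_eq_image)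
    have surj: "surj \<tau>" using Z(3)[OF \<tau>(1)] by (rule permutes_surj)
    \<comment> \<open>Since \<tau> is surjective it cancels on the right, so right multiplication by
      \<tau> carries the stabiliser of \<open>x\<close> onto the fibre over
      \<open>y\<close>.\<close>
    have "x \<circ> \<sigma> \<circ> \<tau> = x \<circ> \<tau> \<longleftrightarrow> x \<circ> \<sigma> = x" for \<sigma>
      using surj unfolding fun_eq_iff comp_def by (metis surjD)
    then have "bij_betw (\<lambda>\<sigma>. \<sigma> \<circ> \<tau>) {\<sigma>\<in>Z. x \<circ> \<sigma> = x} {\<sigma>\<in>Z. x \<circ> \<sigma> = y}"
      using bij_betw_comp_right_subgroup[OF assms \<tau>(1)] \<tau>(2)
      by (intro bij_betw_Collect) (auto simp: comp_assoc)
    then show ?thesis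
      unfolding c_def by (simp add: bij_betw_same_card)
  qed
  have sum_eq: "(\<Sum>\<sigma>\<in>Z. G (x \<circ> \<sigma>)) = real c * (\<Sum>y\<in>perm_orbit Z x. G y)"
    for G :: "(nat \<Rightarrow> real) \<Rightarrow> real"
  proof -
    have "(\<Sum>\<sigma>\<in>Z. G (x \<circ> \<sigma>)) = (\<Sum>y\<in>perm_orbit Z x. \<Sum>\<sigma>\<in>{\<sigma>\<in>Z. x \<circ> \<sigma> = y}. G (x \<circ> \<sigma>))"
      unfolding perm_orbit_eq_image by (rule sum.image_gen[OF Z(1)])
    also have "\<dots> = (\<Sum>y\<in>perm_orbit Z x. real c * G y)"
      by (rule sum.cong) (simp_all add: fibre)
    finally show ?thesis by (simp add: sum_distrib_left)
  qed
  have "card Z \<noteq> 0" using Z(1,2) by auto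
  \<comment> \<open>Orbit-stabiliser: the constant function 1 in \<open>sum_eq\<close> counts both
    sides, so the factor \<open>c\<close> cancels from the average.\<close>
  moreover have "real (card Z) = real c * real (card (perm_orbit Z x))"
    using sum_eq[of "\<lambda>_. 1"] by simp
  ultimately show ?thesis
    using sum_eq[of F] by (auto simp: field_simps)
qed

lemma acts_transitively_onD:
  assumes "acts_transitively_on d H \<phi> E"
  shows "E \<noteq> {}"
    and "\<And>a b. a \<in> E \<Longrightarrow> b \<in> E \<Longrightarrow> \<exists>\<rho>\<in>H. \<phi> \<rho> a = b"
proof -
  have orbits: "{orbit ((sym_group d)\<lparr>carrier := H\<rparr>) \<phi> a | a. a \<in> E} = {E}"
    using assms by (simp add: acts_transitively_on_def orbits_def)
  \<comment> \<open>An empty \<open>E\<close> would have no orbits at all, whereas here there is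
    exactly one.\<close>
  show "E \<noteq> {}" using orbits by auto
  show "\<exists>\<rho>\<in>H. \<phi> \<rho> a = b" if "a \<in> E" "b \<in> E" for a b
  proof -
    have "orbit ((sym_group d)\<lparr>carrier := H\<rparr>) \<phi> a = E"
      using orbits that(1) by blast
    then show ?thesis using that(2) by (auto simp: orbit_def)
  qed
qed

text \<open>Transitivity speaks of tuples of length exactly \<open>k\<close>, so \<open>K\<close> is
  first enlarged to a \<open>k\<close>-element set \<open>L\<close>; an enumeration
  \<open>xs\<close> of \<open>L\<close> and its image under \<tau> are then two admissible
  tuples.\<close>

lemma multiply_transitive_agree_on:
  assumes "multiply_transitive d k Z" "K \<subseteq> {1..d}" "card K \<le> k" "\<tau> permutes {1..d}"
  obtains \<rho> where "\<rho> \<in> Z" "\<And>i. i \<in> K \<Longrightarrow> \<rho> i = \<tau> i"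
proof -
  note tr = acts_transitively_onD[OF assms(1)[unfolded multiply_transitive_def]]
  obtain zs where zs: "length zs = k" "distinct zs" "set zs \<subseteq> {1..d}"
    using tr(1) by auto
  \<comment> \<open>Some admissible tuple exists, hence \<open>k\<close> is at most \<open>d\<close>
    and there is room for \<open>L\<close>.\<close>
  have "k \<le> card {1..d}"
    using card_mono[OF _ zs(3)] zs(1,2) by (simp add: distinct_card)
  then obtain L where L: "K \<subseteq> L" "L \<subseteq> {1..d}" "card L = k"
    using exists_subset_between[OF assms(3) _ assms(2)] by auto
  obtain xs where xs: "set xs = L" "distinct xs"
    using finite_distinct_list[of L] L(2) finite_subset by blast
  have "length xs = k" using xs L(3) distinct_card by fastforce
  moreover have "distinct (map \<tau> xs)"
    using xs(2) permutes_inj_on[OF assms(4)] by (simp add: distinct_map)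
  moreover have "set (map \<tau> xs) \<subseteq> {1..d}"
    using xs(1) L(2) permutes_image[OF assms(4)] by auto
  ultimately obtain \<rho> where "\<rho> \<in> Z" "map \<rho> xs = map \<tau> xs"
    using tr(2)[of xs "map \<tau> xs"] xs L(2) by auto
  then show thesis using that xs(1) L(1) by (auto simp: subset_iff)
qed

lemma homogeneous_same_image:
  assumes "homogeneous d k Z" "K \<subseteq> {1..d}" "card K = k" "\<tau> permutes {1..d}"
  obtains \<rho> where "\<rho> \<in> Z" "\<rho> ` K = \<tau> ` K"
proof -
  have "\<tau> ` K \<subseteq> {1..d}" using permutes_image[OF assms(4)] assms(2) by blast
  moreover have "card (\<tau> ` K) = k"
    using assms(3) permutes_inj_on[OF assms(4)] by (simp add: card_image)
  ultimately show thesis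
    using acts_transitively_onD(2)[OF assms(1)[unfolded homogeneous_def], of K "\<tau> ` K"]
      assms(2,3) that by auto
qed

definition monomial_eval :: "(nat \<Rightarrow>\<^sub>0 nat) \<Rightarrow> (nat \<Rightarrow> real) \<Rightarrow> real" where
  "monomial_eval m y = (\<Prod>i\<in>Poly_Mapping.keys m. y i ^ Poly_Mapping.lookup m i)"

lemma monomial_degree_ge_card: "card (Poly_Mapping.keys m) \<le> monomial_degree m"
  unfolding monomial_degree_def card_eq_sum
  by (rule sum_mono) (simp add: in_keys_iff)

text \<open>Every exponent on the support is at least 1, so a single exponent of 2 or more would
  push the degree above the number of variables.\<close>

lemma lookup_eq_1_if_monomial_degree_le_card:
  assumes "monomial_degree m \<le> card (Poly_Mapping.keys m)" "i \<in> Poly_Mapping.keys m"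
  shows "Poly_Mapping.lookup m i = 1"
proof (rule ccontr)
  assume "Poly_Mapping.lookup m i \<noteq> 1"
  then have "card (Poly_Mapping.keys m) < monomial_degree m"
    unfolding monomial_degree_def card_eq_sum
    using assms(2) by (intro sum_strict_mono_ex1) (auto simp: in_keys_iff intro!: bexI[of _ i])
  then show False using assms(1) by simp
qed

lemma monomial_eval_comp_eq_member:
  assumes Z: "subgroup Z (sym_group d)"
    and trans: "multiply_transitive d (t - 1) Z" and hom: "homogeneous d t Z"
    and m: "Poly_Mapping.keys m \<subseteq> {1..d}" "monomial_degree m \<le> t"
    and \<tau>: "\<tau> permutes {1..d}"
  obtains \<rho> where "\<rho> \<in> Z" "\<And>y. monomial_eval m (y \<circ> \<tau>) = monomial_eval m (y \<circ> \<rho>)"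
proof (cases "card (Poly_Mapping.keys m) \<le> t - 1")
  case True
  obtain \<rho> where "\<rho> \<in> Z" "\<And>i. i \<in> Poly_Mapping.keys m \<Longrightarrow> \<rho> i = \<tau> i"
    using multiply_transitive_agree_on[OF trans m(1) True \<tau>] by blast
  then show thesis using that by (simp add: monomial_eval_def)
next
  case False
  \<comment> \<open>The number of variables exceeds \<open>t - 1\<close> and is bounded by the
    degree, hence by \<open>t\<close>.\<close>
  then have card: "card (Poly_Mapping.keys m) = t"
    using monomial_degree_ge_card[of m] m(2) by simp
  then obtain \<rho> where \<rho>: "\<rho> \<in> Z" "\<rho> ` Poly_Mapping.keys m = \<tau> ` Poly_Mapping.keys m"
    using homogeneous_same_image[OF hom m(1) _ \<tau>] by blast
  have exps: "Poly_Mapping.lookup m i = 1" if "i \<in> Poly_Mapping.keys m" for i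
    using lookup_eq_1_if_monomial_degree_le_card[OF _ that] m(2) card by simp
  \<comment> \<open>With all exponents 1 the value depends on \<open>p\<close> only through the
    image of the set of variables, which is all that homogeneity controls.\<close>
  have "monomial_eval m (y \<circ> p) = prod y (p ` Poly_Mapping.keys m)" if "p permutes {1..d}" for y p
    using permutes_inj_on[OF that] exps
    by (simp add: monomial_eval_def prod.reindex)
  then show thesis
    using that[OF \<rho>(1)] \<rho>(2) \<tau> subgroup_sym_groupD(3)[OF Z \<rho>(1)] by simp
qed

lemma monomial_group_average_eq:
  assumes Z: "subgroup Z (sym_group d)"
    and "multiply_transitive d (t - 1) Z" "homogeneous d t Z"
    and "Poly_Mapping.keys m \<subseteq> {1..d}" "monomial_degree m \<le> t"
  shows "1 / real (card (carrier (sym_group d))) *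
           (\<Sum>\<tau>\<in>carrier (sym_group d). monomial_eval m (x \<circ> \<tau>))
       = 1 / real (card Z) * (\<Sum>\<sigma>\<in>Z. monomial_eval m (x \<circ> \<sigma>))"
proof -
  let ?S = "carrier (sym_group d)" and ?M = "monomial_eval m"
  have S: "?S = {p. p permutes {1..d}}" by (simp add: sym_group_def)
  have "(\<Sum>\<sigma>\<in>Z. ?M (x \<circ> \<sigma> \<circ> \<tau>)) = (\<Sum>\<sigma>\<in>Z. ?M (x \<circ> \<sigma>))" if \<tau>: "\<tau> \<in> ?S" for \<tau>
  proof -
    \<comment> \<open>One \<rho> serves all \<open>y\<close>, in particular every x \<circ>
      \<sigma>; right multiplication by \<rho> then merely permutes the summands over
      \<open>Z\<close>.\<close>
    obtain \<rho> where \<rho>: "\<rho> \<in> Z" "\<And>y. ?M (y \<circ> \<tau>) = ?M (y \<circ> \<rho>)"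
      using monomial_eval_comp_eq_member[OF assms] \<tau> S by blast
    then show ?thesis
      using sum.reindex_bij_betw[OF bij_betw_comp_right_subgroup[OF Z \<rho>(1)], of "\<lambda>\<sigma>. ?M (x \<circ> \<sigma>)"]
      by (simp add: comp_assoc[symmetric])
  qed
  \<comment> \<open>The sum over all pairs (\<sigma>, \<tau>) is evaluated in both orders: the inner
    sum over \<open>Z\<close> does not depend on \<tau>, and the inner sum over \<open>?S\<close>
    does not depend on \<sigma>, because left composition with \<sigma> permutes
    \<open>?S\<close>.\<close>
  then have "real (card ?S) * (\<Sum>\<sigma>\<in>Z. ?M (x \<circ> \<sigma>)) = (\<Sum>\<tau>\<in>?S. \<Sum>\<sigma>\<in>Z. ?M (x \<circ> \<sigma> \<circ> \<tau>))"
    by simp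
  also have "\<dots> = (\<Sum>\<sigma>\<in>Z. \<Sum>\<tau>\<in>?S. ?M (x \<circ> (\<sigma> \<circ> \<tau>)))"
    by (subst sum.swap) (simp add: comp_assoc)
  also have "\<dots> = (\<Sum>\<sigma>\<in>Z. \<Sum>\<tau>\<in>?S. ?M (x \<circ> \<tau>))"
    unfolding S
    by (rule sum.cong[OF refl], rule setum_permutations_compose_left[symmetric])
       (rule subgroup_sym_groupD(3)[OF Z])
  finally have "real (card ?S) * (\<Sum>\<sigma>\<in>Z. ?M (x \<circ> \<sigma>)) = real (card Z) * (\<Sum>\<tau>\<in>?S. ?M (x \<circ> \<tau>))"
    by simp
  moreover have "card Z \<noteq> 0" "card ?S \<noteq> 0"
    using subgroup_sym_groupD(1,2)[OF Z]
      subgroup_sym_groupD(1,2)[OF group.subgroup_self[OF sym_group_is_group]]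
    by (auto simp: card_eq_0_iff)
  ultimately show ?thesis by (simp add: field_simps)
qed

theorem theorem3p3:
  fixes d t :: nat
    and Z :: "(nat \<Rightarrow> nat) set"
    and x :: "nat \<Rightarrow> real"
    and f :: real_mpoly
  assumes "d \<ge> 1" and "t \<ge> 1"
    and "subgroup Z (sym_group d)"
    and "multiply_transitive d (t - 1) Z"
    and "homogeneous d t Z"
    and "x \<in> {1..d} \<rightarrow>\<^sub>E UNIV"
    and "f \<in> mpolys_le d t"
  shows "1 / real (card (perm_orbit (carrier (sym_group d)) x)) *
           (\<Sum>y\<in>perm_orbit (carrier (sym_group d)) x. mpoly_eval f y)
       = 1 / real (card (perm_orbit Z x)) * (\<Sum>y\<in>perm_orbit Z x. mpoly_eval f y)"
proof -
  let ?S = "carrier (sym_group d)"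
  have S: "subgroup ?S (sym_group d)"
    by (rule group.subgroup_self[OF sym_group_is_group])
  \<comment> \<open>Stated for arbitrary \<open>H\<close> so that both group averages split into
    monomials in the same way and can be compared term by term.\<close>
  have linear: "1 / real (card H) * (\<Sum>\<sigma>\<in>H. mpoly_eval f (x \<circ> \<sigma>))
      = (\<Sum>m\<in>Poly_Mapping.keys f. Poly_Mapping.lookup f m *
           (1 / real (card H) * (\<Sum>\<sigma>\<in>H. monomial_eval m (x \<circ> \<sigma>))))" for H
    unfolding mpoly_eval_def monomial_eval_def[symmetric]
    by (subst sum.swap) (simp add: sum_distrib_left mult.left_commute)
  have "1 / real (card ?S) * (\<Sum>\<sigma>\<in>?S. mpoly_eval f (x \<circ> \<sigma>))
      = 1 / real (card Z) * (\<Sum>\<sigma>\<in>Z. mpoly_eval f (x \<circ> \<sigma>))"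
    unfolding linear using assms(7) monomial_group_average_eq[OF assms(3-5)]
    by (intro sum.cong) (auto simp: mpolys_le_def)
  then show ?thesis
    by (simp only: orbit_average_eq_group_average[OF S] orbit_average_eq_group_average[OF assms(3)])
qed

end
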